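(* For every integer $n \geq 7$, $rsat(n,C_6) \leq 2n-2+2\varepsilon$, where $\varepsilon\in\{0,1,2\}$ satisfies $\varepsilon \equiv n-1 \pmod 3$.
   Context: All graphs are finite, simple and undirected. An edge-coloring of a graph $G$ is a function $\mathcal{C}:E(G)\to\mathbb{N}$; a (sub)graph is rainbow if all its edges have distinct colors. An edge-colored graph $G$ is $F$-rainbow saturated if it contains no rainbow copy of $F$ but adding any nonedge of $G$ with any color on it creates a rainbow copy of $F$. $rsat(n,F)$ is the minimum number of edges of a graph on $n$ vertices admitting an edge-coloring that makes it $F$-rainbow saturated. $C_r$ is the cycle on $r$ vertices. *)

theory Defs
  imports "HOL-Library.Extended_Nat" "HOL-Number_Theory.Cong"
begin

type_synonym 'a graph = "'a set \<times> 'a set set"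

abbreviation verts :: "'a graph \<Rightarrow> 'a set" where
  "verts \<equiv> fst"

abbreviation edges :: "'a graph \<Rightarrow> 'a set set" where
  "edges \<equiv> snd"

definition simple_graph :: "'a graph \<Rightarrow> bool" where
  "simple_graph G \<longleftrightarrow>
     finite (verts G) \<and> edges G \<subseteq> {e. e \<subseteq> verts G \<and> card e = 2}"

definition subgraph :: "'a graph \<Rightarrow> 'a graph \<Rightarrow> bool" where
  "subgraph H G \<longleftrightarrow>
     simple_graph H \<and> verts H \<subseteq> verts G \<and> edges H \<subseteq> edges G"

definition isomorphic :: "'a graph \<Rightarrow> 'b graph \<Rightarrow> bool" where
  "isomorphic G H \<longleftrightarrow>
     (\<exists>f. bij_betw f (verts G) (verts H) \<and> (\<lambda>e. f ` e) ` edges G = edges H)"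

definition nonedges :: "'a graph \<Rightarrow> 'a set set" where
  "nonedges G = {e. e \<subseteq> verts G \<and> card e = 2} - edges G"

definition add_edge :: "'a graph \<Rightarrow> 'a set \<Rightarrow> 'a graph" where
  "add_edge G e = (verts G, insert e (edges G))"

(* An edge-coloring is a total function on sets of vertices; only its values on the
   edges of the graph matter. It need not be proper. *)
type_synonym 'a edge_coloring = "'a set \<Rightarrow> nat"

definition rainbow :: "'a edge_coloring \<Rightarrow> 'a graph \<Rightarrow> bool" where
  "rainbow c H \<longleftrightarrow> inj_on c (edges H)"

definition has_rainbow_copy :: "'b graph \<Rightarrow> 'a graph \<Rightarrow> 'a edge_coloring \<Rightarrow> bool" where
  "has_rainbow_copy F G c \<longleftrightarrow> (\<exists>H. subgraph H G \<and> isomorphic F H \<and> rainbow c H)"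

definition rainbow_saturated :: "'b graph \<Rightarrow> 'a graph \<Rightarrow> 'a edge_coloring \<Rightarrow> bool" where
  "rainbow_saturated F G c \<longleftrightarrow>
     \<not> has_rainbow_copy F G c \<and>
     (\<forall>e \<in> nonedges G. \<forall>k. has_rainbow_copy F (add_edge G e) (c(e := k)))"

(* Every finite graph has an isomorphic copy with vertices in nat, so it suffices to range
   over those. The value lies in enat so that it would be infinite, rather than 0, if no
   saturated graph on n vertices existed; otherwise the infimum is an attained minimum. *)
definition rsat :: "nat \<Rightarrow> 'b graph \<Rightarrow> enat" where
  "rsat n F = Inf {enat (card (edges G)) | G :: nat graph.
     simple_graph G \<and> card (verts G) = n \<and> (\<exists>c. rainbow_saturated F G c)}"

lemma rsat_le_iff:
  "rsat n F \<le> enat m \<longleftrightarrow>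
     (\<exists>(G :: nat graph) c. simple_graph G \<and> card (verts G) = n \<and>
        rainbow_saturated F G c \<and> card (edges G) \<le> m)"
    (is "?L \<longleftrightarrow> ?R")
proof
  assume L: ?L
  define A where "A = {enat (card (edges G)) | G :: nat graph.
     simple_graph G \<and> card (verts G) = n \<and> (\<exists>c. rainbow_saturated F G c)}"
  have le: "Inf A \<le> enat m"
    using L unfolding rsat_def A_def .
  then have "A \<noteq> {}"
    by (auto simp: top_enat_def)
  then have "Inf A \<in> A"
    unfolding Inf_enat_def by (auto intro: LeastI)
  then obtain G :: "nat graph" and c where "Inf A = enat (card (edges G))"
    "simple_graph G" "card (verts G) = n" "rainbow_saturated F G c"
    unfolding A_def by blast
  then show ?R
    using le by (metis enat_ord_simps(1))
next
  assume ?R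
  then obtain G :: "nat graph" and c where
    "simple_graph G" "card (verts G) = n" "rainbow_saturated F G c" "card (edges G) \<le> m"
    by blast
  then show ?L
    unfolding rsat_def
    by (intro Inf_lower2[of "enat (card (edges G))"] CollectI exI[of _ G]) auto
qed

(* A cycle only for r at least 3. *)
definition cycle_graph :: "nat \<Rightarrow> nat graph" where
  "cycle_graph r = ({..<r}, {{i, (i + 1) mod r} | i. i < r})"

end

theory Submission
  imports Defs "HOL-Library.Disjoint_Sets"
begin

text \<open>
  Glue copies of \<open>K\<^sub>4\<close> and exactly \<open>\<epsilon>\<close> copies of \<open>K\<^sub>5\<close> together at one common vertex \<open>w\<close>
  and give all edges distinct colors. A 6-cycle would lie in a single block, but blocks have at
  most five vertices. A nonedge \<open>uv\<close> joins two different blocks, and a color occurs in at most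
  one of them; the one containing it still has a path of length 2 to \<open>w\<close> avoiding that color,
  which a path of length 3 in the other block and the new edge complete to a rainbow 6-cycle.
\<close>

text \<open>The members of \<open>P\<close> are the blocks with the common vertex \<open>w\<close>
  removed, so a \<open>B\<close> with 3 or 4 elements stands for a \<open>K_4\<close> or
  \<open>K_5\<close>.\<close>

definition windmill :: "'a \<Rightarrow> 'a set set \<Rightarrow> 'a graph" where
  "windmill w P = (insert w (\<Union>P), {e. card e = 2 \<and> (\<exists>B\<in>P. e \<subseteq> insert w B)})"

section \<open>Rainbow 6-cycles as cyclic sequences of six vertices\<close>

lemma cycle_graph_6:
  "cycle_graph 6 = ({0, 1, 2, 3, 4, 5}, {{0, 1}, {1, 2}, {2, 3}, {3, 4}, {4, 5}, {5, 0}})"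
proof -
  have "{..<6} = {0, 1, 2, 3, 4, 5 :: nat}"
    by auto
  moreover have "{{i, (i + 1) mod 6} | i. i < 6} = (\<lambda>i. {i, (i + 1) mod 6}) ` {..<6 :: nat}"
    by auto
  ultimately show ?thesis
    unfolding cycle_graph_def by (simp flip: numeral_2_eq_2)
qed

lemma has_rainbow_copy_cycle_6I:
  assumes dist: "distinct [x0, x1, x2, x3, x4, x5]"
    and verts: "{x0, x1, x2, x3, x4, x5} \<subseteq> verts G"
    and edges: "{{x0, x1}, {x1, x2}, {x2, x3}, {x3, x4}, {x4, x5}, {x5, x0}} \<subseteq> edges G"
    and inj: "inj_on c {{x0, x1}, {x1, x2}, {x2, x3}, {x3, x4}, {x4, x5}, {x5, x0}}"
  shows "has_rainbow_copy (cycle_graph 6) G c"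
proof -
  define H where "H = ({x0, x1, x2, x3, x4, x5},
    {{x0, x1}, {x1, x2}, {x2, x3}, {x3, x4}, {x4, x5}, {x5, x0}})"
  define f where "f = (\<lambda>i. [x0, x1, x2, x3, x4, x5] ! i)"
  have f: "f 0 = x0" "f 1 = x1" "f (Suc 0) = x1" "f 2 = x2" "f 3 = x3" "f 4 = x4" "f 5 = x5"
    by (simp_all add: f_def)
  have "simple_graph H"
    using dist by (auto simp: simple_graph_def H_def card_insert_if)
  then have "subgraph H G"
    using verts edges by (simp add: subgraph_def H_def)
  moreover have "isomorphic (cycle_graph 6) H"
    unfolding isomorphic_def cycle_graph_6 H_def
    by (rule exI[of _ f]) (use dist f in \<open>auto simp: bij_betw_def\<close>)
  moreover have "rainbow c H"
    using inj by (simp add: rainbow_def H_def)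
  ultimately show ?thesis
    unfolding has_rainbow_copy_def by blast
qed

text \<open>Only the cycle is extracted, not its colors, since the windmill will be shown to contain
  no 6-cycle at all.\<close>

lemma has_rainbow_copy_cycle_6E:
  assumes "has_rainbow_copy (cycle_graph 6) G c"
  obtains x0 x1 x2 x3 x4 x5 where "distinct [x0, x1, x2, x3, x4, x5]"
    "{{x0, x1}, {x1, x2}, {x2, x3}, {x3, x4}, {x4, x5}, {x5, x0}} \<subseteq> edges G"
proof -
  obtain H where sub: "subgraph H G" and iso: "isomorphic (cycle_graph 6) H"
    using assms unfolding has_rainbow_copy_def by blast
  have H: "edges H \<subseteq> edges G"
    using sub by (simp add: subgraph_def)
  obtain f where f: "bij_betw f (verts (cycle_graph 6)) (verts H)"
      "(\<lambda>e. f ` e) ` edges (cycle_graph 6) = edges H"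
    using iso unfolding isomorphic_def by blast
  have "inj_on f {0, 1, 2, 3, 4, 5}"
    using f(1) by (simp add: cycle_graph_6 bij_betw_def)
  then have "distinct [f 0, f 1, f 2, f 3, f 4, f 5]"
    by (simp add: inj_on_def)
  moreover have "{{f 0, f 1}, {f 1, f 2}, {f 2, f 3}, {f 3, f 4}, {f 4, f 5}, {f 5, f 0}} \<subseteq> edges G"
    using f(2) H by (simp add: cycle_graph_6)
  ultimately show thesis
    by (rule that)
qed

section \<open>Windmills with small blocks contain no 6-cycle\<close>

lemma simple_graph_windmill:
  assumes "finite P" "\<And>B. B \<in> P \<Longrightarrow> finite B"
  shows "simple_graph (windmill w P)"
proof -
  have "finite (\<Union>P)"
    using assms by (rule finite_Union)
  then show ?thesis
    by (auto simp: simple_graph_def windmill_def)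
qed

text \<open>An edge avoiding \<open>w\<close> lies inside a member of \<open>P\<close>. Consecutive
  edges of the path share a vertex other than \<open>w\<close>, so disjointness keeps the path in
  one member.\<close>

lemma windmill_path_in_block:
  assumes disj: "disjoint P"
    and edges: "{{x1, x2}, {x2, x3}, {x3, x4}, {x4, x5}} \<subseteq> edges (windmill w P)"
    and w: "w \<notin> {x1, x2, x3, x4, x5}"
  obtains B where "B \<in> P" "{x1, x2, x3, x4, x5} \<subseteq> B"
proof -
  obtain B1 B2 B3 B4 where B: "B1 \<in> P" "B2 \<in> P" "B3 \<in> P" "B4 \<in> P"
    and sub: "{x1, x2} \<subseteq> B1" "{x2, x3} \<subseteq> B2" "{x3, x4} \<subseteq> B3" "{x4, x5} \<subseteq> B4"
    using edges w by (fastforce simp: windmill_def)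
  have "B1 = B2" "B2 = B3" "B3 = B4"
    using disjointD[OF disj B(1,2)] disjointD[OF disj B(2,3)] disjointD[OF disj B(3,4)] sub
    by auto
  then show thesis
    using that B sub by blast
qed

text \<open>Whether or not a 6-cycle passes through \<open>w\<close>, it contains a path on five
  vertices avoiding \<open>w\<close>. Such a path would have to fit into one member of
  \<open>P\<close>, which has at most four elements.\<close>

lemma windmill_no_cycle_6:
  assumes disj: "disjoint P"
    and fin: "\<And>B. B \<in> P \<Longrightarrow> finite B"
    and card: "\<And>B. B \<in> P \<Longrightarrow> card B \<le> 4"
  shows "\<not> has_rainbow_copy (cycle_graph 6) (windmill w P) c"
proof
  assume "has_rainbow_copy (cycle_graph 6) (windmill w P) c"
  then obtain x0 x1 x2 x3 x4 x5 where dist: "distinct [x0, x1, x2, x3, x4, x5]"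
    and edges: "{{x0, x1}, {x1, x2}, {x2, x3}, {x3, x4}, {x4, x5}, {x5, x0}}
      \<subseteq> edges (windmill w P)"
    by (rule has_rainbow_copy_cycle_6E)
  have no_path: False
    if d: "distinct [y1, y2, y3, y4, y5]"
      and e: "{{y1, y2}, {y2, y3}, {y3, y4}, {y4, y5}} \<subseteq> edges (windmill w P)"
      and w: "w \<notin> {y1, y2, y3, y4, y5}" for y1 y2 y3 y4 y5
  proof -
    obtain B where B: "B \<in> P" "{y1, y2, y3, y4, y5} \<subseteq> B"
      using windmill_path_in_block[of P y1 y2 y3 y4 y5 w] disj e w by blast
    have "card {y1, y2, y3, y4, y5} = 5"
      using d by simp
    then show False
      using card_mono[OF fin[OF B(1)] B(2)] card[OF B(1)] by simp
  qed
  \<comment> \<open>The case \<open>w = x0\<close> falls under the last alternative, together with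
    the cycles that miss \<open>w\<close>.\<close>
  consider "w = x1" | "w = x2" | "w = x3" | "w = x4" | "w = x5" | "w \<notin> {x1, x2, x3, x4, x5}"
    by blast
  then show False
  proof cases
    case 1
    show False
      by (rule no_path[of x2 x3 x4 x5 x0]) (use dist edges 1 in auto)
  next
    case 2
    show False
      by (rule no_path[of x3 x4 x5 x0 x1]) (use dist edges 2 in auto)
  next
    case 3
    show False
      by (rule no_path[of x4 x5 x0 x1 x2]) (use dist edges 3 in auto)
  next
    case 4
    show False
      by (rule no_path[of x5 x0 x1 x2 x3]) (use dist edges 4 in auto)
  next
    case 5
    show False
      by (rule no_path[of x0 x1 x2 x3 x4]) (use dist edges 5 in auto)
  next
    case 6
    show False
      by (rule no_path[of x1 x2 x3 x4 x5]) (use dist edges 6 in auto)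
  qed
qed

section \<open>Adding a nonedge creates a rainbow 6-cycle\<close>

lemma obtain_two_others:
  assumes "card A \<ge> 3"
  obtains x y where "x \<in> A" "y \<in> A" "x \<noteq> y" "x \<noteq> a" "y \<noteq> a"
proof -
  have "card (A - {a}) \<ge> 2"
    using assms by (cases "a \<in> A") (auto simp: card_Diff_singleton_if)
  then obtain T where "T \<subseteq> A - {a}" "card T = 2"
    by (meson obtain_subset_with_card_n)
  then show thesis
    using that unfolding card_2_iff by blast
qed

lemma inj_on_fun_upd_insert:
  assumes "k \<notin> f ` A" "a \<notin> A" "inj_on f A"
  shows "inj_on (f(a := k)) (insert a A)"
proof -
  have "inj_on (f(a := k)) A"
    using assms(3,1) by (rule inj_on_fun_updI)
  moreover have "f(a := k) ` A = f ` A"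
    using assms(2) by (intro image_cong) auto
  ultimately show ?thesis
    using assms(1,2) by (simp del: fun_upd_image)
qed

text \<open>The cycle is v, u, x, w, y, z: two edges in the block of u, where the color
  \<open>k\<close> may occur, and three in the block of v, where it does not. Only the choice of x
  has to dodge \<open>k\<close>.\<close>

lemma windmill_add_edge_has_rainbow_cycle_6:
  assumes disj: "disjoint P" and w: "w \<notin> \<Union>P"
    and AB: "A \<in> P" "B \<in> P" "A \<noteq> B"
    and card: "card A \<ge> 3" "card B \<ge> 3"
    and uv: "u \<in> A" "v \<in> B"
    and inj: "inj_on c (edges (windmill w P))"
    and k: "\<And>e. card e = 2 \<Longrightarrow> e \<subseteq> insert w B \<Longrightarrow> c e \<noteq> k"
  shows "has_rainbow_copy (cycle_graph 6) (add_edge (windmill w P) {u, v}) (c({u, v} := k))"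
proof -
  have AB_disj: "A \<inter> B = {}"
    using disj AB by (meson disjointD)
  have wAB: "w \<notin> A" "w \<notin> B"
    using w AB by auto
  have E: "{a, b} \<in> edges (windmill w P)"
    if "D \<in> P" "a \<in> insert w D" "b \<in> insert w D" "a \<noteq> b" for D a b
    using that by (auto simp: windmill_def)
  have uw: "u \<noteq> w"
    using uv wAB by blast
  \<comment> \<open>The paths u, y, w and u, z, w share no edge, and by injectivity at most one edge
    has color \<open>k\<close>, so one of the two paths avoids it.\<close>
  obtain x where x: "x \<in> A" "x \<noteq> u" "c {u, x} \<noteq> k" "c {x, w} \<noteq> k"
  proof -
    obtain y z where yz: "y \<in> A" "z \<in> A" "y \<noteq> z" "y \<noteq> u" "z \<noteq> u"
      using obtain_two_others[OF card(1)] .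
    have yzw: "y \<noteq> w" "z \<noteq> w"
      using yz wAB by auto
    have mem: "{u, y} \<in> edges (windmill w P)" "{y, w} \<in> edges (windmill w P)"
      "{u, z} \<in> edges (windmill w P)" "{z, w} \<in> edges (windmill w P)"
      using E[OF AB(1)] uv yz yzw by auto
    have neq: "{u, y} \<noteq> {u, z}" "{u, y} \<noteq> {z, w}" "{y, w} \<noteq> {u, z}" "{y, w} \<noteq> {z, w}"
      using yz yzw uw by (auto simp: doubleton_eq_iff)
    have "c {u, y} \<noteq> k \<and> c {y, w} \<noteq> k \<or> c {u, z} \<noteq> k \<and> c {z, w} \<noteq> k"
      using inj_on_eq_iff[OF inj] mem neq by metis
    then show thesis
      using that yz by blast
  qed
  obtain y z where yz: "y \<in> B" "z \<in> B" "y \<noteq> z" "y \<noteq> v" "z \<noteq> v"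
    using obtain_two_others[OF card(2)] .
  have dist: "distinct [v, u, x, w, y, z]"
    using x yz uv AB_disj wAB by auto
  \<comment> \<open>Since the new edge is not an old one, coloring it with \<open>k\<close> changes
    no color on the rest of the cycle.\<close>
  have nonedge: "{v, u} \<notin> edges (windmill w P)"
  proof
    assume "{v, u} \<in> edges (windmill w P)"
    then obtain D where D: "D \<in> P" "u \<in> D" "v \<in> D"
      using uv wAB by (auto simp: windmill_def)
    then show False
      using disjointD[OF disj D(1) AB(1)] disjointD[OF disj D(1) AB(2)] uv AB(3) by blast
  qed
  let ?E = "{{u, x}, {x, w}, {w, y}, {y, z}, {z, v}}"
  have sub: "?E \<subseteq> edges (windmill w P)"
    using E[OF AB(1)] E[OF AB(2)] dist uv x yz by auto
  have "c {w, y} \<noteq> k" "c {y, z} \<noteq> k" "c {z, v} \<noteq> k"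
    using dist uv yz by (intro k; auto)+
  then have "k \<notin> c ` ?E"
    using x by auto
  moreover have "{v, u} \<notin> ?E"
    using sub nonedge by blast
  moreover have "inj_on c ?E"
    using inj_on_subset[OF inj sub] .
  ultimately have "inj_on (c({v, u} := k)) (insert {v, u} ?E)"
    by (intro inj_on_fun_upd_insert)
  then have "inj_on (c({v, u} := k)) {{v, u}, {u, x}, {x, w}, {w, y}, {y, z}, {z, v}}" .
  moreover have "{v, u, x, w, y, z} \<subseteq> verts (add_edge (windmill w P) {v, u})"
    using uv x yz AB by (auto simp: add_edge_def windmill_def)
  moreover have "{{v, u}, {u, x}, {x, w}, {w, y}, {y, z}, {z, v}}
      \<subseteq> edges (add_edge (windmill w P) {v, u})"
    using sub by (auto simp: add_edge_def)
  ultimately have "has_rainbow_copy (cycle_graph 6) (add_edge (windmill w P) {v, u})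
      (c({v, u} := k))"
    using dist by (intro has_rainbow_copy_cycle_6I)
  then show ?thesis
    by (simp add: insert_commute)
qed

lemma windmill_rainbow_saturated:
  assumes disj: "disjoint P" and w: "w \<notin> \<Union>P"
    and card: "\<And>B. B \<in> P \<Longrightarrow> card B \<in> {3, 4}"
    and inj: "inj_on c (edges (windmill w P))"
  shows "rainbow_saturated (cycle_graph 6) (windmill w P) c"
  unfolding rainbow_saturated_def
proof (intro conjI ballI allI)
  show "\<not> has_rainbow_copy (cycle_graph 6) (windmill w P) c"
    \<comment> \<open>A positive cardinality forces the set to be finite.\<close>
    using card by (intro windmill_no_cycle_6 disj) (force intro: card_ge_0_finite)+
next
  fix e k
  assume "e \<in> nonedges (windmill w P)"
  then have e: "e \<subseteq> insert w (\<Union>P)" "card e = 2" "\<And>B. B \<in> P \<Longrightarrow> \<not> e \<subseteq> insert w B"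
    by (auto simp: nonedges_def windmill_def)
  then obtain u v where uv: "e = {u, v}" "u \<noteq> v"
    by (meson card_2_iff)
  have not_both: "\<not> (u \<in> insert w D \<and> v \<in> insert w D)" if "D \<in> P" for D
    using e(3)[OF that] uv(1) by simp
  \<comment> \<open>The vertex \<open>w\<close> is adjacent to all others, so neither end of a
    nonedge is \<open>w\<close>. With \<open>P\<close> nonempty, \<open>not_both\<close> also rules
    out both ends being \<open>w\<close>.\<close>
  have "u \<in> insert w (\<Union>P)" "v \<in> insert w (\<Union>P)" "P \<noteq> {}"
    using e(1,2) uv by auto
  then obtain A B where AB: "A \<in> P" "B \<in> P" "u \<in> A" "v \<in> B"
    using not_both by blast
  then have "A \<noteq> B"
    using not_both by blast
  have card3: "card A \<ge> 3" "card B \<ge> 3"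
    using card[OF AB(1)] card[OF AB(2)] by auto
  \<comment> \<open>Edges of color \<open>k\<close> in both blocks would coincide by injectivity,
    but the two blocks share only the vertex \<open>w\<close>.\<close>
  have "(\<forall>e. card e = 2 \<longrightarrow> e \<subseteq> insert w A \<longrightarrow> c e \<noteq> k)
      \<or> (\<forall>e. card e = 2 \<longrightarrow> e \<subseteq> insert w B \<longrightarrow> c e \<noteq> k)"
  proof (rule ccontr)
    assume "\<not> ?thesis"
    then obtain e1 e2 where e12: "card e1 = 2" "e1 \<subseteq> insert w A" "c e1 = k"
      "card e2 = 2" "e2 \<subseteq> insert w B" "c e2 = k"
      by blast
    then have "e1 = e2"
      using AB by (intro inj_onD[OF inj]) (auto simp: windmill_def)
    moreover have "A \<inter> B = {}"
      using disjointD[OF disj AB(1,2) \<open>A \<noteq> B\<close>] .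
    ultimately have "e1 \<subseteq> {w}"
      using e12 by blast
    then have "card e1 \<le> 1"
      by (metis card_mono finite.emptyI finite.insertI is_singletonI is_singleton_altdef)
    then show False
      using e12(1) by simp
  qed
  then show "has_rainbow_copy (cycle_graph 6) (add_edge (windmill w P) e) (c(e := k))"
  proof
    assume "\<forall>e. card e = 2 \<longrightarrow> e \<subseteq> insert w A \<longrightarrow> c e \<noteq> k"
    \<comment> \<open>Here the block of u is free of \<open>k\<close>, so u and v exchange
      roles.\<close>
    then have "has_rainbow_copy (cycle_graph 6) (add_edge (windmill w P) {v, u}) (c({v, u} := k))"
      using AB \<open>A \<noteq> B\<close> card3
      by (intro windmill_add_edge_has_rainbow_cycle_6[OF disj w _ _ _ _ _ _ _ inj]) auto
    then show ?thesis
      by (simp add: uv insert_commute)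
  next
    assume "\<forall>e. card e = 2 \<longrightarrow> e \<subseteq> insert w B \<longrightarrow> c e \<noteq> k"
    then show ?thesis
      unfolding uv(1) using AB \<open>A \<noteq> B\<close> card3
      by (intro windmill_add_edge_has_rainbow_cycle_6[OF disj w _ _ _ _ _ _ _ inj]) auto
  qed
qed

section \<open>Edge count and choice of the blocks\<close>

lemma card_edges_windmill_le:
  assumes "finite P" and fin: "\<And>B. B \<in> P \<Longrightarrow> finite B" and w: "w \<notin> \<Union>P"
  shows "card (edges (windmill w P)) \<le> (\<Sum>B\<in>P. Suc (card B) choose 2)"
proof -
  have "edges (windmill w P) = (\<Union>B\<in>P. {e. e \<subseteq> insert w B \<and> card e = 2})"
    by (auto simp: windmill_def)
  then have "card (edges (windmill w P)) \<le> (\<Sum>B\<in>P. card {e. e \<subseteq> insert w B \<and> card e = 2})"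
    using card_UN_le[OF assms(1)] by simp
  also have "\<dots> = (\<Sum>B\<in>P. Suc (card B) choose 2)"
    using w fin by (intro sum.cong) (auto simp: n_subsets)
  finally show ?thesis .
qed

text \<open>Blocks are split off one at a time. The clause on \<open>g\<close> records that every
  entry of \<open>ms\<close>, repetitions included, is the size of its own block; it turns the edge
  count into a sum over \<open>ms\<close>.\<close>

lemma partition_into_sizes:
  assumes "finite S" "card S = sum_list ms" "0 \<notin> set ms"
  obtains P where "finite P" "disjoint P" "\<Union>P = S" "\<And>B. B \<in> P \<Longrightarrow> card B \<in> set ms"
    "\<And>g :: nat \<Rightarrow> nat. (\<Sum>B\<in>P. g (card B)) = sum_list (map g ms)"
proof -
  have "\<exists>P. finite P \<and> disjoint P \<and> \<Union>P = S \<and> (\<forall>B\<in>P. card B \<in> set ms)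
      \<and> (\<forall>g :: nat \<Rightarrow> nat. (\<Sum>B\<in>P. g (card B)) = sum_list (map g ms))"
    using assms
  proof (induction ms arbitrary: S)
    case Nil
    then show ?case by (intro exI[of _ "{}"]) auto
  next
    case (Cons m ms)
    then obtain T where T: "T \<subseteq> S" "card T = m" "finite T"
      by (metis le_add1 obtain_subset_with_card_n sum_list.Cons)
    have "card (S - T) = sum_list ms"
      using T Cons.prems by (simp add: card_Diff_subset)
    with Cons obtain P where P: "finite P" "disjoint P" "\<Union>P = S - T"
      "\<forall>B\<in>P. card B \<in> set ms"
      "\<forall>g :: nat \<Rightarrow> nat. (\<Sum>B\<in>P. g (card B)) = sum_list (map g ms)"
      by (metis finite_Diff list.set_intros(2))
    \<comment> \<open>A nonempty \<open>T\<close> cannot already be in \<open>P\<close>, whose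
      members lie in \<open>S - T\<close>; so inserting it really adds a summand.\<close>
    have "T \<noteq> {}"
      using T(2) Cons.prems(3) by auto
    then have "T \<notin> P"
      using P(3) by blast
    moreover have "disjoint (insert T P)"
      using P(2,3) by (auto simp: pairwise_insert disjnt_def)
    ultimately show ?case
      using P T by (intro exI[of _ "insert T P"]) auto
  qed
  then show thesis
    using that by blast
qed

theorem theorem1p4:
  fixes n \<epsilon> :: nat
  assumes "n \<ge> 7"
    and "\<epsilon> \<in> {0, 1, 2}"
    and "[\<epsilon> = n - 1] (mod 3)"
  shows "rsat n (cycle_graph 6) \<le> enat (2 * n - 2 + 2 * \<epsilon>)"
proof -
  \<comment> \<open>The number of \<open>K_4\<close> blocks: if n - 1 = 3q + \<epsilon>, then n - 1
    = 3(q - \<epsilon>) + 4\<epsilon>, which leaves q - \<epsilon> triples beside \<epsilon>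
    quadruples.\<close>
  define a where "a = (n - 1) div 3 - \<epsilon>"
  have n: "n - 1 = 3 * a + 4 * \<epsilon>"
  proof -
    have "\<epsilon> = (n - 1) mod 3"
      using assms(2,3) by (auto simp: cong_def)
    then have "n - 1 = 3 * ((n - 1) div 3) + \<epsilon>"
      by (metis mult_div_mod_eq)
    \<comment> \<open>As n is at least 7, the quotient is at least 2, so the truncated subtraction
      in \<open>a\<close> is exact.\<close>
    moreover have "\<epsilon> \<le> (n - 1) div 3"
      using assms(1,2) by (auto simp: less_eq_div_iff_mult_less_eq)
    ultimately show ?thesis
      unfolding a_def diff_mult_distrib2 by linarith
  qed
  define ms where "ms = replicate a 3 @ replicate \<epsilon> (4 :: nat)"
  have "card {1..<n} = sum_list ms" "0 \<notin> set ms"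
    using n by (auto simp: ms_def sum_list_replicate)
  then obtain P where P: "finite P" "disjoint P" "\<Union>P = {1..<n}"
    "\<And>B. B \<in> P \<Longrightarrow> card B \<in> set ms"
    "\<And>g :: nat \<Rightarrow> nat. (\<Sum>B\<in>P. g (card B)) = sum_list (map g ms)"
    using partition_into_sizes[of "{1..<n}" ms] by blast
  have card: "card B \<in> {3, 4}" if "B \<in> P" for B
    using P(4)[OF that] by (auto simp: ms_def split: if_splits)
  have fin: "finite B" if "B \<in> P" for B
    using P(3) that by (metis Union_upper finite_atLeastLessThan finite_subset)
  have w: "0 \<notin> \<Union>P"
    using P(3) by simp
  let ?G = "windmill 0 P"
  have simple: "simple_graph ?G"
    using P(1) fin by (rule simple_graph_windmill)
  have "verts ?G = {..<n}"
    using P(3) assms(1) by (auto simp: windmill_def)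
  then have card_verts: "card (verts ?G) = n"
    by simp
  have "finite (edges ?G)"
    using simple by (auto simp: simple_graph_def intro: finite_subset[of _ "Pow (verts ?G)"])
  then obtain c :: "nat set \<Rightarrow> nat" where "inj_on c (edges ?G)"
    using finite_imp_inj_to_nat_seg[of "edges ?G"] by blast
  then have sat: "rainbow_saturated (cycle_graph 6) ?G c"
    using windmill_rainbow_saturated[OF P(2) w card] by blast
  have "card (edges ?G) \<le> (\<Sum>B\<in>P. Suc (card B) choose 2)"
    using P(1) fin w by (rule card_edges_windmill_le)
  \<comment> \<open>A \<open>K_4\<close> has 6 edges and a \<open>K_5\<close> has 10; the total is
    2(3a + 4\<epsilon>) + 2\<epsilon> = 2(n - 1) + 2\<epsilon>.\<close>
  also have "\<dots> = 6 * a + 10 * \<epsilon>"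
    using P(5)[of "\<lambda>m. Suc m choose 2"]
    by (simp add: ms_def sum_list_replicate choose_two)
  also have "\<dots> = 2 * n - 2 + 2 * \<epsilon>"
    using n by simp
  finally show ?thesis
    using simple card_verts sat unfolding rsat_le_iff by blast
qed

end
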